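(* Let $k\ge 2$ be an integer. Define \[P_k(z)=\frac{(2\pi)^{2k-1}}{(2k)!}\sum_{j=0}^{k}(-1)^j B_{2j}B_{2k-2j}\binom{2k}{2j}z^{2j}+\zeta(2k-1)\left(z^{2k-1}+(-1)^k z\right)\] and \[W_{k}(z)=(2^{2k-1}+2)P_k(z)-2^{2k}P_k(z/2)- P_k(2z),\] which equals \[W_k(z)=\frac{(2\pi)^{2k-1}2^{2k}}{(2k)!}\sum_{j=0}^k (-1)^j B_{2j}B_{2k-2j} (1-2^{1-2j})(1-2^{1-2k+2j})\binom{2k}{2j} z^{2j}.\] Then all of the zeros of $W_k(z)$ lie on the unit circle $|z|=1$, and all of the zeros are simple.
   Context: $B_n$ denotes the $n$th Bernoulli number, defined by $\dfrac{t}{e^t-1}=\sum_{n\ge0}B_n\dfrac{t^n}{n!}$, and $\zeta$ is the Riemann zeta function.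
   Formalization: The closed form printed for W_k(z) is twice the defining combination (for k=2, j=0 the factors are −14 versus −7); the formal statement keeps the definition of W_k and corrects the prefactor from 2^{2k} to 2^{2k−1}. The claim on the zeros is unchanged. *)

theory Defs
  imports "HOL-Complex_Analysis.Complex_Analysis"
begin

text \<open>
  The coefficients are read off the generating function \<open>t / (e\<^sup>t - 1) = \<Sum>n. B\<^sub>n t\<^sup>n / n!\<close>.
  Division of formal power series cancels the common factor \<open>t\<close>, so this is the genuine quotient;
  in particular \<open>B\<^sub>1 = -1/2\<close>.
\<close>

definition bernoulli :: "nat \<Rightarrow> real" where
  "bernoulli n = fact n * fps_nth (fps_X / (fps_exp 1 - 1)) n"

text \<open>
  The Dirichlet series \<open>\<Sum>n\<ge>1. n\<^sup>-\<^sup>s\<close>, which is the Riemann zeta function on the half-plane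
  \<open>Re s > 1\<close>. Outside that half-plane the value is not meaningful; only \<open>s = 2k - 1\<close> with
  \<open>k \<ge> 2\<close> is used.
\<close>

definition zeta :: "complex \<Rightarrow> complex" where
  "zeta s = (\<Sum>n. 1 / of_nat (Suc n) powr s)"

definition P :: "nat \<Rightarrow> complex \<Rightarrow> complex" where
  "P k z =
     of_real ((2 * pi) ^ (2 * k - 1) / fact (2 * k)) *
       (\<Sum>j=0..k. (-1) ^ j * of_real (bernoulli (2 * j)) * of_real (bernoulli (2 * k - 2 * j)) *
          of_nat ((2 * k) choose (2 * j)) * z ^ (2 * j)) +
     zeta (of_nat (2 * k - 1)) * (z ^ (2 * k - 1) + (-1) ^ k * z)"

definition W :: "nat \<Rightarrow> complex \<Rightarrow> complex" where
  "W k z = (2 ^ (2 * k - 1) + 2) * P k z - 2 ^ (2 * k) * P k (z / 2) - P k (2 * z)"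

end

theory Submission
  imports Defs
begin

text \<open>
  Let \<open>\<eta>(s) = \<Sum>n\<ge>1. (-1)\<^sup>n\<^sup>-\<^sup>1 n\<^sup>-\<^sup>s\<close>, with \<open>\<eta>(0) = 1/2\<close>. Euler's formula for the Bernoulli numbers shows that
  \<open>W\<^sub>k(z)\<close> is a nonzero multiple of \<open>Q(-z\<^sup>2)\<close>, where \<open>Q(w) = \<Sum>j\<le>k. \<eta>(2j) \<eta>(2k-2j) w\<^sup>j\<close>. Since
  \<open>0 \<le> 1 - \<eta>(2j) \<le> 4\<^sup>-\<^sup>j\<close>, on the unit circle \<open>Q(y\<^sup>2)\<close> differs by at most \<open>(k + 5/3) 4\<^sup>-\<^sup>k\<close> from
  \<open>A(y) + y\<^sup>2\<^sup>k cnj (A(y))\<close>, where \<open>A(y) = (\<pi>y/2) / sin (\<pi>y)\<close> is the sum of \<open>\<eta>(2j) y\<^sup>2\<^sup>j\<close>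
  for \<open>|y| < 1\<close>. Hence \<open>y\<^sup>-\<^sup>k Q(y\<^sup>2)\<close>, which is real, is \<open>2 Re (y\<^sup>-\<^sup>k A(y))\<close> up to an error smaller than \<open>2 |A(y)|\<close>. As \<open>y = e\<^sup>i\<^sup>\<phi>\<close> runs over
  the upper half circle, the phase of \<open>y\<^sup>-\<^sup>k A(y)\<close> goes from \<open>\<pi>/2\<close> to \<open>-k\<pi> - \<pi>/2\<close>, so it passes through
  \<open>0, -\<pi>, \<dots>, -k\<pi>\<close>, where the real function has alternating signs. This yields \<open>k\<close> distinct zeros of \<open>Q\<close>
  on the unit circle, and \<open>Q\<close> has degree \<open>k\<close>.
\<close>

subsection \<open>Partial fractions of the cotangent\<close>

text \<open>Logarithmic differentiation of
  \<open>Gamma z * Gamma (1 - z) = pi / sin (pi * z)\<close>.\<close>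

lemma Digamma_reflection_complex:
  fixes z :: complex
  assumes "z \<notin> \<int>"
  shows "Digamma (1 - z) - Digamma z = of_real pi * cot (of_real pi * z)"
proof -
  have nz: "sin (of_real pi * z) \<noteq> 0"
    using assms by (auto simp: sin_eq_0 mult.commute)
  have z1: "z \<notin> \<int>\<^sub>\<le>\<^sub>0"
    using assms nonpos_Ints_Int by blast
  have z2: "1 - z \<notin> \<int>\<^sub>\<le>\<^sub>0"
  proof
    assume "1 - z \<in> \<int>\<^sub>\<le>\<^sub>0"
    then have "1 - (1 - z) \<in> \<int>" by (intro Ints_diff Ints_1 nonpos_Ints_Int)
    then show False using assms by simp
  qed
  have "((\<lambda>w. Gamma w * Gamma (1 - w)) has_field_derivative
          (Gamma z * Gamma (1 - z)) * (Digamma z - Digamma (1 - z))) (at z)"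
    by (auto intro!: derivative_eq_intros z1 z2 simp: algebra_simps)
  then have d1: "((\<lambda>w. of_real pi / sin (of_real pi * w)) has_field_derivative
          (of_real pi / sin (of_real pi * z)) * (Digamma z - Digamma (1 - z))) (at z)"
    unfolding Gamma_reflection_complex .
  have d2: "((\<lambda>w. of_real pi / sin (of_real pi * w)) has_field_derivative
          - (of_real pi / sin (of_real pi * z)) * (of_real pi * cot (of_real pi * z))) (at z)"
    using nz by (auto intro!: derivative_eq_intros simp: cot_def power2_eq_square)
  have "Digamma z - Digamma (1 - z) = - (of_real pi * cot (of_real pi * z))"
  proof -
    have "of_real pi / sin (of_real pi * z) \<noteq> (0 :: complex)" using nz by simp
    then show ?thesis
      using DERIV_unique[OF d1 d2] by (metis minus_mult_commute mult_left_cancel)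
  qed
  then show ?thesis by (simp add: algebra_simps)
qed

lemma cot_partial_fractions:
  fixes z :: complex
  assumes "z \<notin> \<int>"
  shows "(\<lambda>n. 2 * z\<^sup>2 / ((of_nat (Suc n))\<^sup>2 - z\<^sup>2)) sums (1 - of_real pi * z * cot (of_real pi * z))"
proof -
  have nz: "z \<noteq> 0" using assms by auto
  have ne: "of_nat (Suc n) - z \<noteq> 0" "of_nat (Suc n) + z \<noteq> 0" for n
  proof -
    show "of_nat (Suc n) - z \<noteq> 0"
      by (metis assms Ints_of_nat eq_iff_diff_eq_0)
    show "of_nat (Suc n) + z \<noteq> 0"
      by (metis assms Ints_of_nat Ints_minus add_eq_0_iff)
  qed
  have n0: "1 - z \<noteq> 0" "1 + z \<noteq> 0" using ne[of 0] by auto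
  \<comment> \<open>The logarithms in the two Digamma limits cancel, which leaves the partial sums
    of 1/(n+1-z) - 1/(n+1+z).\<close>
  have "(\<lambda>m. (of_real (ln (real m)) - (\<Sum>n<m. inverse (1 + z + of_nat n))) -
             (of_real (ln (real m)) - (\<Sum>n<m. inverse (1 - z + of_nat n))))
          \<longlonglongrightarrow> Digamma (1 + z) - Digamma (1 - z)"
    by (intro tendsto_diff Digamma_LIMSEQ n0)
  moreover have "Digamma (1 + z) - Digamma (1 - z) = 1 / z - of_real pi * cot (of_real pi * z)"
    using Digamma_plus1[OF nz] Digamma_reflection_complex[OF assms] by (simp add: add.commute algebra_simps)
  ultimately have "(\<lambda>n. inverse (1 - z + of_nat n) - inverse (1 + z + of_nat n)) sums
      (1 / z - of_real pi * cot (of_real pi * z))"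
    by (simp add: sums_def sum_subtractf)
  from sums_mult[OF this, of z] have "(\<lambda>n. z * (inverse (1 - z + of_nat n) - inverse (1 + z + of_nat n))) sums
      (1 - of_real pi * z * cot (of_real pi * z))"
    using nz by (simp add: algebra_simps)
  moreover have "z * (inverse (1 - z + of_nat n) - inverse (1 + z + of_nat n)) =
      2 * z\<^sup>2 / ((of_nat (Suc n))\<^sup>2 - z\<^sup>2)" for n
  proof -
    have a: "1 - z + of_nat n \<noteq> 0" "1 + z + of_nat n \<noteq> 0" using ne[of n] by (simp_all add: algebra_simps)
    have b: "(of_nat (Suc n))\<^sup>2 - z\<^sup>2 = (1 - z + of_nat n) * (1 + z + of_nat n)"
      by (simp add: power2_eq_square algebra_simps)
    show ?thesis unfolding b using a by (simp add: divide_simps power2_eq_square)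
  qed
  ultimately show ?thesis by simp
qed

definition zeta_even :: "nat \<Rightarrow> real" where
  "zeta_even j = (\<Sum>n. 1 / real (Suc n) ^ (2 * j))"

lemma zeta_even_sums:
  assumes "j \<ge> 1"
  shows "(\<lambda>n. 1 / real (Suc n) ^ (2 * j)) sums zeta_even j"
proof -
  have "summable (\<lambda>n. inverse (real n ^ (2 * j)))"
    using assms by (intro inverse_power_summable) auto
  then have "summable (\<lambda>n. inverse (real (Suc n) ^ (2 * j)))"
    by (subst summable_Suc_iff)
  then show ?thesis
    unfolding zeta_even_def by (intro summable_sums) (simp add: inverse_eq_divide)
qed

text \<open>Each partial fraction is a geometric series in (z/(n+1))^2. Absolute summability of the
  double family allows the order of summation to be exchanged.\<close>

lemma cot_power_series:
  fixes z :: complex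
  assumes "norm z < 1" "z \<noteq> 0"
  shows "(\<lambda>j. 2 * of_real (zeta_even (Suc j)) * z ^ (2 * Suc j)) sums
           (1 - of_real pi * z * cot (of_real pi * z))"
proof -
  have zint: "z \<notin> \<int>"
  proof
    assume "z \<in> \<int>"
    then obtain m where "z = of_int m" by (auto elim: Ints_cases)
    with assms show False by auto
  qed
  define f where "f = (\<lambda>(n, j). 2 * (z\<^sup>2 / (of_nat (Suc n))\<^sup>2) ^ Suc j)"
  define r where "r n = norm (z\<^sup>2 / (of_nat (Suc n))\<^sup>2)" for n :: nat
  have z2: "norm z ^ 2 < 1" using assms by (simp add: power_less_one_iff)
  have rle: "r n \<le> norm z ^ 2 / real (Suc n) ^ 2" for n
    unfolding r_def norm_divide norm_power norm_of_nat by simp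
  also have "\<dots> n \<le> norm z ^ 2" for n
    by (simp add: divide_le_eq mult_le_cancel_left1)
  finally have r1: "r n \<le> norm z ^ 2" for n .
  have r_less: "r n < 1" for n using r1[of n] z2 by linarith
  have r_nonneg: "r n \<ge> 0" for n by (simp add: r_def)
  have normf: "norm (f (n, j)) = 2 * r n * r n ^ j" for n j
    by (simp add: f_def r_def norm_mult norm_power norm_divide)
  have row_norm: "((\<lambda>j. norm (f (n, j))) has_sum (2 * r n * (1 / (1 - r n)))) UNIV" for n
    unfolding normf using r_less[of n] r_nonneg[of n]
    by (intro sums_nonneg_imp_has_sum sums_mult geometric_sums mult_nonneg_nonneg) auto
  have row: "((\<lambda>j. f (n, j)) has_sum (2 * z\<^sup>2 / ((of_nat (Suc n))\<^sup>2 - z\<^sup>2))) UNIV" for n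
  proof (rule norm_summable_imp_has_sum)
    show "summable (\<lambda>j. norm (f (n, j)))"
      using has_sum_imp_sums[OF row_norm[of n]] by (rule sums_summable)
    let ?w = "z\<^sup>2 / (of_nat (Suc n))\<^sup>2"
    have w: "norm ?w < 1" using r_less[of n] by (simp add: r_def)
    have "(\<lambda>j. 2 * ?w * ?w ^ j) sums (2 * ?w * (1 / (1 - ?w)))"
      by (intro sums_mult geometric_sums w)
    moreover have "2 * ?w * (1 / (1 - ?w)) = 2 * z\<^sup>2 / ((of_nat (Suc n))\<^sup>2 - z\<^sup>2)"
    proof -
      have "1 - ?w \<noteq> 0" using w by auto
      moreover have nn: "(of_nat (Suc n))\<^sup>2 \<noteq> (0::complex)" using of_nat_neq_0[of n] by (metis power_not_zero)
      ultimately have "(of_nat (Suc n))\<^sup>2 - z\<^sup>2 \<noteq> 0" by auto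
      with nn show ?thesis
        by (simp add: divide_simps del: of_nat_Suc)
    qed
    ultimately show "(\<lambda>j. f (n, j)) sums (2 * z\<^sup>2 / ((of_nat (Suc n))\<^sup>2 - z\<^sup>2))"
      unfolding f_def by (simp only: case_prod_conv power_Suc mult.assoc)
  qed
  \<comment> \<open>The row sums of norms are at most a constant times 1/(n+1)^2, because
    \<open>1 - r n\<close> is at least \<open>1 - norm z ^ 2\<close>.\<close>
  have "summable (\<lambda>n. 2 * r n * (1 / (1 - r n)))"
  proof (rule summable_comparison_test)
    have "2 * r n * (1 / (1 - r n)) \<le> (2 * norm z ^ 2 * (1 / (1 - norm z ^ 2))) * (1 / real (Suc n) ^ (2 * 1))" for n
    proof -
      have "2 * r n * (1 / (1 - r n)) \<le> 2 * (norm z ^ 2 / real (Suc n) ^ 2) * (1 / (1 - norm z ^ 2))"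
      using rle[of n] r1[of n] r_less[of n] r_nonneg[of n] z2
      by (intro mult_mono divide_left_mono) auto
      then show ?thesis by (simp add: mult.commute)
    qed
    moreover have "2 * r n * (1 / (1 - r n)) \<ge> 0" for n
      using r_less[of n] r_nonneg[of n] by (intro mult_nonneg_nonneg divide_nonneg_nonneg) auto
    ultimately show "\<exists>N. \<forall>n\<ge>N. norm (2 * r n * (1 / (1 - r n))) \<le>
        (2 * norm z ^ 2 * (1 / (1 - norm z ^ 2))) * (1 / real (Suc n) ^ (2 * 1))"
      by (intro exI[of _ 0] allI impI) (simp only: real_norm_def abs_of_nonneg)
    show "summable (\<lambda>n. (2 * norm z ^ 2 * (1 / (1 - norm z ^ 2))) * (1 / real (Suc n) ^ (2 * 1)))"
      by (intro summable_mult sums_summable[OF zeta_even_sums]) simp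
  qed
  then have sr: "(\<lambda>n. 2 * r n * (1 / (1 - r n))) summable_on UNIV"
    using r_less r_nonneg
    by (subst summable_on_UNIV_nonneg_real_iff) (auto intro!: mult_nonneg_nonneg divide_nonneg_nonneg simp: less_imp_le)
  have "(\<lambda>x. norm (f x)) summable_on (UNIV \<times> UNIV)"
    by (rule summable_on_SigmaI[where g = "\<lambda>n. 2 * r n * (1 / (1 - r n))"]) (use row_norm sr in auto)
  then have sf: "f summable_on (UNIV \<times> UNIV)"
    by (rule abs_summable_summable)
  define S where "S = infsum f (UNIV \<times> UNIV)"
  have hs: "(f has_sum S) (UNIV \<times> UNIV)"
    unfolding S_def using sf by (rule has_sum_infsum)
  have "((\<lambda>n. 2 * z\<^sup>2 / ((of_nat (Suc n))\<^sup>2 - z\<^sup>2)) has_sum S) UNIV"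
    using has_sum_SigmaD[OF hs, of "\<lambda>n. 2 * z\<^sup>2 / ((of_nat (Suc n))\<^sup>2 - z\<^sup>2)"] row by blast
  then have S: "S = 1 - of_real pi * z * cot (of_real pi * z)"
    using cot_partial_fractions[OF zint] has_sum_imp_sums sums_unique2 by blast
  have hs': "((\<lambda>(j, n). f (n, j)) has_sum S) (UNIV \<times> UNIV)"
    using hs by (subst (asm) has_sum_swap) 
  have col: "((\<lambda>n. f (n, j)) has_sum (2 * of_real (zeta_even (Suc j)) * z ^ (2 * Suc j))) UNIV" for j
  proof -
    have "((\<lambda>n. 1 / real (Suc n) ^ (2 * Suc j)) has_sum zeta_even (Suc j)) UNIV"
      by (intro sums_nonneg_imp_has_sum zeta_even_sums) auto
    then have "((\<lambda>n. complex_of_real (1 / real (Suc n) ^ (2 * Suc j))) has_sum of_real (zeta_even (Suc j))) UNIV"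
      by (rule has_sum_of_real)
    then have "((\<lambda>n. (2 * z ^ (2 * Suc j)) * complex_of_real (1 / real (Suc n) ^ (2 * Suc j))) has_sum
        (2 * z ^ (2 * Suc j)) * of_real (zeta_even (Suc j))) UNIV"
      by (rule has_sum_cmult_right)
    moreover have "(2 * z ^ (2 * Suc j)) * complex_of_real (1 / real (Suc n) ^ (2 * Suc j)) = f (n, j)" for n
      unfolding f_def by (simp only: case_prod_conv power_divide power_mult of_real_divide of_real_power of_real_of_nat_eq) simp
    ultimately show ?thesis by (simp add: mult_ac)
  qed
  have "((\<lambda>j. 2 * of_real (zeta_even (Suc j)) * z ^ (2 * Suc j)) has_sum S) UNIV"
    by (rule has_sum_SigmaD[OF hs']) (use col in auto)
  then show ?thesis unfolding S by (rule has_sum_imp_sums)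
qed

subsection \<open>Bernoulli numbers and the alternating zeta function\<close>

text \<open>
  These are the values \<open>\<eta>(2j)\<close>. The series defining \<open>zeta_even\<close> diverges at \<open>j = 0\<close>, where the analytic
  continuation of \<open>\<eta>\<close> has the value \<open>1/2\<close>.
\<close>

definition eta_even :: "nat \<Rightarrow> real" where
  "eta_even j = (if j = 0 then 1 / 2 else (1 - 2 / 4 ^ j) * zeta_even j)"

text \<open>Subtracting twice the terms with even denominator flips their signs. Because of the
  shift by \<open>Suc\<close> these are the terms of odd index, and they add up to
  \<open>zeta_even j / 4 ^ j\<close>.\<close>

lemma eta_even_sums:
  assumes "j \<ge> 1"
  shows "(\<lambda>n. (-1) ^ n * (1 / real (Suc n) ^ (2 * j))) sums eta_even j"
proof -
  define f where "f n = 1 / real (Suc n) ^ (2 * j)" for n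
  have f: "f sums zeta_even j"
    unfolding f_def using assms by (rule zeta_even_sums)
  have odd_f: "f (2 * n + 1) = f n / 4 ^ j" for n
  proof -
    have "real (Suc (2 * n + 1)) = 2 * real (Suc n)" by simp
    then show ?thesis unfolding f_def by (simp add: power_mult power_mult_distrib del: of_nat_Suc)
  qed
  have "(\<lambda>n. (\<lambda>m. if odd m then f m else 0) (2 * n + 1)) sums (zeta_even j / 4 ^ j)"
    using sums_divide[OF f] odd_f by simp
  then have "(\<lambda>m. if odd m then f m else 0) sums (zeta_even j / 4 ^ j)"
    by (subst (asm) sums_mono_reindex) (auto simp: strict_mono_def elim: oddE)
  from sums_diff[OF f sums_mult[OF this, of 2]]
  have "(\<lambda>n. f n - 2 * (if odd n then f n else 0)) sums eta_even j"
    using assms by (simp add: eta_even_def algebra_simps)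
  moreover have "f n - 2 * (if odd n then f n else 0) = (-1) ^ n * f n" for n
    by auto
  ultimately show ?thesis by (simp add: f_def)
qed

text \<open>Leibniz bounds for an alternating series, cut after two terms and after one.\<close>

lemma eta_even_bounds:
  assumes "j \<ge> 1"
  shows "1 - 1 / 4 ^ j \<le> eta_even j" "eta_even j \<le> 1"
proof -
  define a where "a n = 1 / real (Suc n) ^ (2 * j)" for n
  have "a \<longlonglongrightarrow> 0"
    unfolding a_def using sums_summable[OF zeta_even_sums[OF assms]] by (rule summable_LIMSEQ_zero)
  moreover have "a n \<ge> 0" for n by (simp add: a_def)
  moreover have "a (Suc n) \<le> a n" for n
    unfolding a_def by (intro divide_left_mono power_mono) auto
  ultimately have "(\<Sum>i<2*1. (-1)^i * a i) \<le> (\<Sum>i. (-1)^i * a i)" "(\<Sum>i. (-1)^i * a i) \<le> (\<Sum>i<2*0+1. (-1)^i * a i)"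
    by (rule summable_Leibniz')+
  moreover have "(\<Sum>i. (-1)^i * a i) = eta_even j"
    using eta_even_sums[OF assms] by (simp add: a_def sums_iff)
  ultimately show "1 - 1 / 4 ^ j \<le> eta_even j" "eta_even j \<le> 1"
    by (simp_all add: a_def lessThan_nat_numeral power_mult lessThan_Suc)
qed

lemma sin_pi_mult_neq_0:
  fixes z :: complex
  assumes "norm z \<le> 1" "z \<notin> {0, 1, -1}"
  shows "sin (of_real pi * z) \<noteq> 0"
proof
  assume "sin (of_real pi * z) = 0"
  then obtain n :: int where n: "of_real pi * z = of_real (of_int n * pi)"
    by (auto simp: sin_eq_0)
  then have z: "z = of_int n" by simp
  with assms(1) have "\<bar>n\<bar> \<le> 1" by simp
  then have "n \<in> {0, 1, -1}" by auto
  with z assms(2) show False by auto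
qed

text \<open>Since cot x - cot (2x) = 1 / sin (2x), the cotangent series at z and at z/2 combine, and
  the factor 1 - 2/4^j turns zeta values into eta values. The value 1/2 of \<open>eta_even 0\<close>
  supplies the constant term.\<close>

lemma csc_power_series:
  fixes z :: complex
  assumes "norm z < 1" "z \<noteq> 0"
  shows "(\<lambda>j. of_real (eta_even j) * z ^ (2 * j)) sums (of_real pi * z / 2 / sin (of_real pi * z))"
proof -
  define x where "x = of_real pi * (z / 2)"
  have "norm (z / 2) < 1" "z / 2 \<noteq> 0" using assms by (auto simp: norm_divide)
  from sums_mult[OF cot_power_series[OF this], of 2] cot_power_series[OF assms]
  have "(\<lambda>j. 2 * of_real (zeta_even (Suc j)) * z ^ (2 * Suc j) -
             2 * (2 * of_real (zeta_even (Suc j)) * (z / 2) ^ (2 * Suc j))) sums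
        ((1 - of_real pi * z * cot (of_real pi * z)) -
         2 * (1 - of_real pi * (z / 2) * cot (of_real pi * (z / 2))))"
    by (intro sums_diff)
  moreover have "2 * of_real (zeta_even (Suc j)) * z ^ (2 * Suc j) -
             2 * (2 * of_real (zeta_even (Suc j)) * (z / 2) ^ (2 * Suc j)) =
        2 * of_real (eta_even (Suc j)) * z ^ (2 * Suc j)" for j
  proof -
    have "(2 :: complex) ^ (2 * Suc j) = 4 ^ Suc j" by (subst power_mult) simp
    then show ?thesis
      unfolding power_divide by (simp add: eta_even_def algebra_simps)
  qed
  ultimately have "(\<lambda>j. 2 * (of_real (eta_even (Suc j)) * z ^ (2 * Suc j))) sums
        (of_real pi * z * (cot x - cot (2 * x)) - 1)"
    by (simp add: x_def algebra_simps)
  from sums_divide[OF this, of 2]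
  have "(\<lambda>j. of_real (eta_even (Suc j)) * z ^ (2 * Suc j)) sums
        (of_real pi * z * (cot x - cot (2 * x)) / 2 - of_real (eta_even 0) * z ^ (2 * 0))"
    by (simp add: eta_even_def diff_divide_distrib)
  then have *: "(\<lambda>j. of_real (eta_even j) * z ^ (2 * j)) sums (of_real pi * z * (cot x - cot (2 * x)) / 2)"
    by (subst (asm) sums_Suc_iff) simp
  have nz: "sin (2 * x) \<noteq> 0"
  proof -
    have "z \<notin> {0, 1, -1}" using assms by auto
    then show ?thesis using sin_pi_mult_neq_0[of z] assms by (simp add: x_def)
  qed
  then have "sin x \<noteq> 0" "cos x \<noteq> 0" by (auto simp: sin_double)
  then have "cot x - cot (2 * x) = 1 / sin (2 * x)"
    by (simp add: cot_def sin_double cos_double divide_simps power2_eq_square)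
  with * show ?thesis by (simp add: x_def mult.commute)
qed

text \<open>Euler's formula, multiplied by 1 - 2/4^j so that j = 0 fits the same pattern. With c = 2
  pi i, the rescaled series cz/(e^(cz) - 1) is identified with pi z cot (pi z) - cz/2: both give cz
  when multiplied by e^(cz) - 1.\<close>

lemma bernoulli_even:
  "bernoulli (2 * j) * (1 - 2 / 4 ^ j) / fact (2 * j) = - 2 * (-1) ^ j * eta_even j / (2 * pi) ^ (2 * j)"
proof -
  define c :: complex where "c = 2 * of_real pi * \<i>"
  define F :: "real fps" where "F = fps_X / (fps_exp 1 - 1)"
  \<comment> \<open>The divisor has subdegree 1, so the division of \<open>fps_X\<close> by it is
    exact.\<close>
  have "subdegree (fps_exp 1 - 1 :: real fps) = 1"
    by (intro subdegreeI) (auto simp: less_Suc_eq)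
  moreover have "(fps_exp 1 - 1 :: real fps) \<noteq> 0"
    using \<open>subdegree (fps_exp 1 - 1 :: real fps) = 1\<close> by force
  ultimately have "(fps_exp 1 - 1 :: real fps) dvd fps_X"
    by (subst fps_dvd_iff) auto
  then have F: "F * (fps_exp 1 - 1) = fps_X"
    unfolding F_def by simp
  define F' :: "complex fps" where "F' = Abs_fps (\<lambda>n. of_real (fps_nth F n) * c ^ n)"
  have F': "F' * (fps_exp c - 1) = fps_const c * fps_X"
  proof (rule fps_ext)
    fix n
    have "fps_nth (F' * (fps_exp c - 1)) n = c ^ n * of_real (fps_nth (F * (fps_exp 1 - 1)) n)"
      unfolding fps_mult_nth of_real_sum sum_distrib_left
    proof (intro sum.cong refl)
      fix i assume "i \<in> {0..n}"
      then have "c ^ n = c ^ i * c ^ (n - i)" by (simp flip: power_add)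
      then show "fps_nth F' i * fps_nth (fps_exp c - 1) (n - i) =
          c ^ n * complex_of_real (fps_nth F i * fps_nth (fps_exp 1 - 1) (n - i))"
        by (simp add: F'_def field_simps)
    qed
    then show "fps_nth (F' * (fps_exp c - 1)) n = fps_nth (fps_const c * fps_X) n"
      unfolding F by (cases "n = 1") auto
  qed
  define G :: "complex fps" where
    "G = Abs_fps (\<lambda>n. if n = 0 then 1 else if even n then - 2 * of_real (zeta_even (n div 2)) else 0)"
  define f where "f z = (if z = 0 then 1 else of_real pi * z * cot (of_real pi * z))" for z :: complex
  have G: "f has_fps_expansion G"
  proof (rule has_fps_expansionI)
    have "(\<lambda>n. fps_nth G n * u ^ n) sums f u" if "u \<in> ball 0 1" for u
    proof (cases "u = 0")
      case True
      then show ?thesis using powser_sums_zero[of "fps_nth G"] by (simp add: f_def G_def)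
    next
      case False
      with that have "(\<lambda>j. - (2 * of_real (zeta_even (Suc j)) * u ^ (2 * Suc j))) sums - (1 - f u)"
        using cot_power_series[of u] by (intro sums_minus) (simp add: f_def)
      then have "(\<lambda>j. (\<lambda>n. if n = 0 then 0 else fps_nth G n * u ^ n) (2 * Suc j)) sums (f u - 1)"
        by (simp add: G_def)
      then have "(\<lambda>n. if n = 0 then 0 else fps_nth G n * u ^ n) sums (f u - 1)"
      proof (subst (asm) sums_mono_reindex)
        fix n assume "n \<notin> range (\<lambda>j. 2 * Suc j)"
        then have "n = 0 \<or> odd n"
          by (metis (no_types, lifting) evenE mult_0_right not0_implies_Suc rangeI)
        then show "(if n = 0 then 0 else fps_nth G n * u ^ n) = 0" by (auto simp: G_def)
      qed (auto simp: strict_mono_def)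
      from sums_add[OF this sums_single[of 0 "\<lambda>_. 1"]]
      have "(\<lambda>n. (if n = 0 then 0 else fps_nth G n * u ^ n) + (if n = 0 then 1 else 0)) sums f u"
        by simp
      moreover have "(\<lambda>n. (if n = 0 then 0 else fps_nth G n * u ^ n) + (if n = 0 then 1 else 0)) = (\<lambda>n. fps_nth G n * u ^ n)"
        by (auto simp: G_def)
      ultimately show ?thesis by simp
    qed
    then show "\<forall>\<^sub>F u in nhds 0. (\<lambda>n. fps_nth G n * u ^ n) sums f u"
      by (intro eventually_nhds_in_open[of "ball 0 1", THEN eventually_mono]) auto
  qed
  have "(\<lambda>z. (f z - c / 2 * z) * (exp (c * z) - 1)) has_fps_expansion
          (G - fps_const (c / 2) * fps_X) * (fps_exp c - 1)"
    by (intro fps_expansion_intros G)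
  moreover have "\<forall>\<^sub>F z in nhds 0. (f z - c / 2 * z) * (exp (c * z) - 1) = c * z"
  proof -
    have "(f z - c / 2 * z) * (exp (c * z) - 1) = c * z" if "z \<in> ball 0 1" for z
    proof (cases "z = 0")
      case False
      with that have s: "sin (of_real pi * z) \<noteq> 0"
        by (intro sin_pi_mult_neq_0) auto
      \<comment> \<open>In terms of E the cotangent is i (E^2 + 1)/(E^2 - 1), and E^2 is the
        exponential in the denominator.\<close>
      define E where "E = exp (\<i> * (of_real pi * z))"
      have E0: "E \<noteq> 0" by (simp add: E_def)
      have E2: "exp (c * z) = E\<^sup>2"
        by (simp add: E_def c_def mult_ac flip: exp_double)
      have Em: "exp (- (\<i> * (of_real pi * z))) = 1 / E"
        by (simp add: E_def exp_minus inverse_eq_divide)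
      have sE: "sin (of_real pi * z) = (E - 1 / E) / (2 * \<i>)"
        by (simp add: sin_exp_eq E_def[symmetric] Em)
      have cE: "cos (of_real pi * z) = (E + 1 / E) / 2"
        by (simp add: cos_exp_eq E_def[symmetric] Em)
      have "E - 1 / E \<noteq> 0" using s sE by auto
      then have E1: "E\<^sup>2 - 1 \<noteq> 0" using E0 by (auto simp: power2_eq_square field_simps)
      have "cot (of_real pi * z) = \<i> * (E\<^sup>2 + 1) / (E\<^sup>2 - 1)"
        unfolding cot_def sE cE using E0 E1 by (simp add: power2_eq_square divide_simps)
      then have "f z * (E\<^sup>2 - 1) = of_real pi * z * \<i> * (E\<^sup>2 + 1)"
        using E1 False by (simp add: f_def)
      then show ?thesis unfolding E2 by (simp add: c_def algebra_simps)
    qed auto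
    then show ?thesis
      by (intro eventually_nhds_in_open[of "ball 0 1", THEN eventually_mono]) auto
  qed
  ultimately have "(\<lambda>z. c * z) has_fps_expansion (G - fps_const (c / 2) * fps_X) * (fps_exp c - 1)"
    by (rule has_fps_expansion_cong[THEN iffD1, rotated -1]) auto
  moreover have "(\<lambda>z. c * z) has_fps_expansion fps_const c * fps_X"
    by (intro fps_expansion_intros)
  ultimately have "(G - fps_const (c / 2) * fps_X) * (fps_exp c - 1) = fps_const c * fps_X"
    by (rule fps_expansion_unique_complex)
  with F' have "(G - fps_const (c / 2) * fps_X) * (fps_exp c - 1) = F' * (fps_exp c - 1)"
    by simp
  moreover have "fps_exp c - 1 \<noteq> 0"
  proof
    assume "fps_exp c - 1 = 0"
    then have "fps_nth (fps_exp c - 1) 1 = 0" by simp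
    then show False by (simp add: c_def)
  qed
  ultimately have "F' = G - fps_const (c / 2) * fps_X" by simp
  then have "fps_nth F' (2 * j) = fps_nth G (2 * j)"
    by simp
  moreover have "c ^ (2 * j) = of_real ((-1) ^ j * (2 * pi) ^ (2 * j))"
  proof -
    have "c\<^sup>2 = of_real (- 1 * (2 * pi)\<^sup>2)" by (simp add: c_def power_mult_distrib)
    then show ?thesis
      unfolding power_mult power_mult_distrib[symmetric] by (simp del: of_real_mult)
  qed
  ultimately have "complex_of_real (fps_nth F (2 * j) * ((-1) ^ j * (2 * pi) ^ (2 * j))) =
      of_real (if j = 0 then 1 else - 2 * zeta_even j)"
    by (simp add: F'_def G_def)
  then have "fps_nth F (2 * j) * ((-1) ^ j * (2 * pi) ^ (2 * j)) = (if j = 0 then 1 else - 2 * zeta_even j)"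
    unfolding of_real_eq_iff .
  then have "fps_nth F (2 * j) = (-1) ^ j * (if j = 0 then 1 else - 2 * zeta_even j) / (2 * pi) ^ (2 * j)"
    by (cases "even j") (auto simp: field_simps)
  moreover have "bernoulli (2 * j) / fact (2 * j) = fps_nth F (2 * j)"
    by (simp add: bernoulli_def F_def)
  ultimately have "bernoulli (2 * j) / fact (2 * j) * (1 - 2 / 4 ^ j) =
      (-1) ^ j * (if j = 0 then 1 else - 2 * zeta_even j) / (2 * pi) ^ (2 * j) * (1 - 2 / 4 ^ j)"
    by simp
  then show ?thesis by (cases "j = 0") (auto simp: eta_even_def)
qed

subsection \<open>Approximation on the unit circle\<close>

text \<open>In the punctured unit disc this is the generating function of \<open>eta_even\<close> in
  even powers. At 0 division by zero yields 0 instead of the limit 1/2.\<close>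

definition csc_gf :: "complex \<Rightarrow> complex" where
  "csc_gf y = of_real pi * y / 2 / sin (of_real pi * y)"

text \<open>The eta values tend to 1, so their own series has radius 1. The defects decay like 4^-j
  and can be summed on the unit circle.\<close>

definition eta_defect :: "nat \<Rightarrow> real" where
  "eta_defect j = 1 - eta_even j"

lemma eta_defect_bounds: "0 \<le> eta_defect j" "eta_defect j \<le> (1 / 4) ^ j"
proof -
  show "0 \<le> eta_defect j"
    by (cases "j = 0") (use eta_even_bounds[of j] in \<open>auto simp: eta_defect_def eta_even_def\<close>)
  show "eta_defect j \<le> (1 / 4) ^ j"
    by (cases "j = 0") (use eta_even_bounds[of j] in \<open>auto simp: eta_defect_def eta_even_def power_divide\<close>)
qed

lemma norm_eta_defect_le: "norm (complex_of_real (eta_defect j)) \<le> (1 / 4) ^ j"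
  using eta_defect_bounds[of j] by simp

lemma summable_eta_defect:
  fixes w :: complex
  assumes "norm w < 4"
  shows "summable (\<lambda>j. of_real (eta_defect j) * w ^ j)"
proof (rule summable_comparison_test)
  have "norm (of_real (eta_defect j) * w ^ j) \<le> (norm w / 4) ^ j" for j
    using mult_right_mono[OF norm_eta_defect_le[of j], of "norm w ^ j"]
    by (simp add: norm_mult norm_power power_divide)
  then show "\<exists>N. \<forall>j\<ge>N. norm (of_real (eta_defect j) * w ^ j) \<le> (norm w / 4) ^ j" by blast
  show "summable (\<lambda>j. (norm w / 4) ^ j)"
    using assms by (intro summable_geometric) simp
qed

text \<open>
  Splitting off the poles \<open>y = \<plusminus>1\<close> leaves a power series that converges beyond the unit circle, so the
  expansion of \<open>csc_gf\<close> extends to the boundary by continuity.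
\<close>

lemma csc_gf_unit_circle:
  assumes "norm y = 1" "y\<^sup>2 \<noteq> 1"
  shows "csc_gf y = 1 / (1 - y\<^sup>2) - (\<Sum>j. of_real (eta_defect j) * (y\<^sup>2) ^ j)"
proof -
  define g where "g x = csc_gf x - 1 / (1 - x\<^sup>2) + (\<Sum>j. of_real (eta_defect j) * (x\<^sup>2) ^ j)" for x
  have inside: "g x = 0" if "norm x < 1" "x \<noteq> 0" for x
  proof -
    have "norm (x\<^sup>2) < 1" using that by (simp add: norm_power power_less_one_iff)
    then have "(\<lambda>j. (x\<^sup>2) ^ j - of_real (eta_defect j) * (x\<^sup>2) ^ j) sums
        (1 / (1 - x\<^sup>2) - (\<Sum>j. of_real (eta_defect j) * (x\<^sup>2) ^ j))"
      by (intro sums_diff geometric_sums summable_sums summable_eta_defect) auto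
    moreover have "(x\<^sup>2) ^ j - of_real (eta_defect j) * (x\<^sup>2) ^ j = of_real (eta_even j) * x ^ (2 * j)" for j
      unfolding power_mult by (simp add: eta_defect_def algebra_simps)
    ultimately have "(\<lambda>j. of_real (eta_even j) * x ^ (2 * j)) sums
        (1 / (1 - x\<^sup>2) - (\<Sum>j. of_real (eta_defect j) * (x\<^sup>2) ^ j))"
      by simp
    then have eq: "csc_gf x = 1 / (1 - x\<^sup>2) - (\<Sum>j. of_real (eta_defect j) * (x\<^sup>2) ^ j)"
      unfolding csc_gf_def by (rule sums_unique2[OF csc_power_series[OF that]])
    show ?thesis unfolding g_def eq by simp
  qed
  have y: "y \<notin> {0, 1, -1}" using assms by auto
  \<comment> \<open>Convergence at w = 2 gives continuity of the power series throughout the disc of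
    radius 2, in particular at \<open>y\<^sup>2\<close>.\<close>
  have "summable (\<lambda>j. complex_of_real (eta_defect j) * 2 ^ j)"
    by (rule summable_eta_defect) simp
  moreover have "norm (y\<^sup>2) < norm (2 :: complex)"
    by (simp add: norm_power assms)
  ultimately have "isCont (\<lambda>w. \<Sum>j. complex_of_real (eta_defect j) * w ^ j) (y\<^sup>2)"
    by (rule isCont_powser)
  moreover have "isCont (\<lambda>x. x\<^sup>2) y" by (intro continuous_intros)
  ultimately have "isCont (\<lambda>x. \<Sum>j. complex_of_real (eta_defect j) * (x\<^sup>2) ^ j) y"
    by (rule isCont_o2[rotated])
  then have cont: "isCont g y"
    unfolding g_def csc_gf_def using sin_pi_mult_neq_0[of y] assms y
    by (intro continuous_intros) auto
  \<comment> \<open>A radial approach to y from inside the disc. The double \<open>Suc\<close> keeps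
    \<open>s 0\<close> away from 0, where the expansion fails.\<close>
  define s where "s n = y * of_real (1 - inverse (real (Suc (Suc n))))" for n
  have "(\<lambda>n. inverse (real (Suc (Suc n)))) \<longlonglongrightarrow> 0"
    using LIMSEQ_inverse_real_of_nat by (rule LIMSEQ_Suc)
  then have "s \<longlonglongrightarrow> y * of_real (1 - 0)"
    unfolding s_def by (intro tendsto_intros)
  then have "s \<longlonglongrightarrow> y" by simp
  then have "(\<lambda>n. g (s n)) \<longlonglongrightarrow> g y"
    by (rule isCont_tendsto_compose[OF cont])
  moreover have "g (s n) = 0" for n
  proof (rule inside)
    have *: "0 < 1 - inverse (real (Suc (Suc n)))" "1 - inverse (real (Suc (Suc n))) < 1"
      by (auto simp: field_simps)
    have "norm (s n) = \<bar>1 - inverse (real (Suc (Suc n)))\<bar>"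
      unfolding s_def norm_mult norm_of_real assms by simp
    with * show "norm (s n) < 1" by linarith
    show "s n \<noteq> 0" unfolding s_def using y * by (simp del: of_real_diff of_nat_Suc)
  qed
  ultimately have "g y = 0" by (simp add: LIMSEQ_const_iff)
  then show ?thesis by (simp add: g_def algebra_simps)
qed

definition eta_poly :: "nat \<Rightarrow> complex \<Rightarrow> complex" where
  "eta_poly k w = (\<Sum>j\<le>k. of_real (eta_even j * eta_even (k - j)) * w ^ j)"

lemma norm_eta_defect_tail_le:
  assumes "norm w = 1"
  shows "norm (\<Sum>j. complex_of_real (eta_defect (j + Suc k)) * w ^ (j + Suc k)) \<le> (1 / 4) ^ k / 3"
proof -
  have geo: "(\<lambda>j. (1 / 4) ^ Suc k * (1 / 4 :: real) ^ j) sums ((1 / 4) ^ Suc k * (1 / (1 - 1 / 4)))"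
    by (intro sums_mult geometric_sums) auto
  have le: "norm (complex_of_real (eta_defect (j + Suc k)) * w ^ (j + Suc k)) \<le> (1 / 4) ^ Suc k * (1 / 4) ^ j" for j
    using norm_eta_defect_le[of "j + Suc k"] assms unfolding norm_mult norm_power
    by (simp add: power_add mult_ac)
  have "norm (\<Sum>j. complex_of_real (eta_defect (j + Suc k)) * w ^ (j + Suc k)) \<le> (\<Sum>j. (1 / 4) ^ Suc k * (1 / 4) ^ j)"
    by (rule norm_suminf_le) (use geo le in \<open>auto simp: sums_iff\<close>)
  also have "\<dots> = (1 / 4) ^ Suc k * (1 / (1 - 1 / 4))"
    using geo by (simp add: sums_iff)
  also have "\<dots> = (1 / 4) ^ k / 3" by simp
  finally show ?thesis .
qed

text \<open>With eta = 1 - e, each coefficient is 1 - e_j - e_(k-j) + e_j e_(k-j). The first three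
  parts sum to the main term up to two tails, each at most 4^-k / 3, and the k + 1 products
  contribute at most 4^-k each.\<close>

lemma eta_poly_unit_circle_approx:
  assumes "norm y = 1" "y\<^sup>2 \<noteq> 1"
  shows "norm (eta_poly k (y\<^sup>2) - (csc_gf y + (y\<^sup>2) ^ k * cnj (csc_gf y))) \<le> (real k + 5 / 3) * (1 / 4) ^ k"
proof -
  define w where "w = y\<^sup>2"
  define e where "e j = complex_of_real (eta_defect j)" for j
  define T where "T = (\<Sum>j. e (j + Suc k) * w ^ (j + Suc k))"
  have w: "norm w = 1" "w \<noteq> 1" using assms by (auto simp: w_def norm_power)
  have ww: "w * cnj w = 1" using w by (simp add: complex_norm_square[symmetric])
  have "summable (\<lambda>j. e j * w ^ j)"
    unfolding e_def using w by (intro summable_eta_defect) auto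
  from suminf_split_initial_segment[OF this, of "Suc k"]
  have A: "csc_gf y = 1 / (1 - w) - (\<Sum>j\<le>k. e j * w ^ j) - T"
    using csc_gf_unit_circle[OF assms] by (simp add: T_def w_def e_def lessThan_Suc_atMost)
  have e_cnj: "cnj (e j) = e j" for j by (simp add: e_def)
  have pw: "w ^ k * cnj w ^ j = w ^ (k - j)" if "j \<le> k" for j
  proof -
    have "w ^ k = w ^ (k - j) * w ^ j" using that by (simp flip: power_add)
    then have "w ^ k * cnj w ^ j = w ^ (k - j) * (w * cnj w) ^ j" by (simp add: power_mult_distrib)
    then show ?thesis by (simp add: ww)
  qed
  have "w ^ k * (\<Sum>j\<le>k. e j * cnj w ^ j) = (\<Sum>j\<le>k. e j * w ^ (k - j))"
    unfolding sum_distrib_left by (intro sum.cong refl) (simp add: pw mult.left_commute)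
  also have "\<dots> = (\<Sum>j\<le>k. e (k - j) * w ^ j)"
    by (rule sum.reindex_bij_witness[of _ "\<lambda>j. k - j" "\<lambda>j. k - j"]) auto
  finally have mirror: "w ^ k * (\<Sum>j\<le>k. e j * cnj w ^ j) = (\<Sum>j\<le>k. e (k - j) * w ^ j)" .
  \<comment> \<open>The finite geometric sum splits into the pole part of \<open>csc_gf y\<close>
    and its mirror image, because \<open>cnj w = 1 / w\<close>.\<close>
  have "(\<Sum>j\<le>k. w ^ j) = 1 / (1 - w) + w ^ k * (1 / (1 - cnj w))"
  proof -
    have "w \<noteq> 0" using w by auto
    moreover from this have "cnj w = 1 / w" using ww by (simp add: eq_divide_eq mult.commute)
    ultimately have "1 / (1 - cnj w) = - w / (1 - w)" using w by (simp add: divide_simps) (simp add: algebra_simps)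
    then show ?thesis using w by (simp add: sum_gp0 diff_divide_distrib)
  qed
  then have "eta_poly k w - (csc_gf y + w ^ k * cnj (csc_gf y)) =
      (\<Sum>j\<le>k. e j * e (k - j) * w ^ j) + T + w ^ k * cnj T"
  proof -
    have "eta_poly k w = (\<Sum>j\<le>k. w ^ j - e j * w ^ j - e (k - j) * w ^ j + e j * e (k - j) * w ^ j)"
      unfolding eta_poly_def by (intro sum.cong refl) (simp add: e_def eta_defect_def algebra_simps)
    also have "\<dots> = (\<Sum>j\<le>k. w ^ j) - (\<Sum>j\<le>k. e j * w ^ j) - w ^ k * (\<Sum>j\<le>k. e j * cnj w ^ j)
        + (\<Sum>j\<le>k. e j * e (k - j) * w ^ j)"
      unfolding mirror by (simp add: sum.distrib sum_subtractf)
    finally show ?thesis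
      unfolding A \<open>(\<Sum>j\<le>k. w ^ j) = _\<close> by (simp add: algebra_simps e_cnj)
  qed
  also have "norm \<dots> \<le> norm (\<Sum>j\<le>k. e j * e (k - j) * w ^ j) + norm T + norm (w ^ k * cnj T)"
    by (intro order.trans[OF norm_triangle_ineq] add_mono order.refl norm_triangle_ineq)
  also have "norm (\<Sum>j\<le>k. e j * e (k - j) * w ^ j) \<le> (\<Sum>j\<le>k. (1 / 4) ^ k)"
  proof (rule sum_norm_le)
    fix j assume j: "j \<in> {..k}"
    have "norm (e j * e (k - j) * w ^ j) \<le> (1 / 4) ^ j * (1 / 4) ^ (k - j)"
      unfolding norm_mult norm_power w e_def
      using mult_mono[OF norm_eta_defect_le[of j] norm_eta_defect_le[of "k - j"]] by simp
    also have "\<dots> = (1 / 4) ^ k" using j by (simp flip: power_add)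
    finally show "norm (e j * e (k - j) * w ^ j) \<le> (1 / 4) ^ k" .
  qed
  also have "norm T \<le> (1 / 4) ^ k / 3"
    unfolding T_def e_def by (rule norm_eta_defect_tail_le[OF w(1)])
  also have "norm (w ^ k * cnj T) \<le> (1 / 4) ^ k / 3"
    using norm_eta_defect_tail_le[OF w(1), of k] by (simp add: norm_mult norm_power w T_def e_def)
  finally show ?thesis by (simp add: w_def algebra_simps)
qed

text \<open>Here |sin (pi y)| is at most (1 + e^pi)/2 < 25/2. The bound 11/96 is half of 11/48, the
  error allowed for the approximation when k is at least 2.\<close>

lemma norm_csc_gf_ge:
  assumes "norm y = 1" "Im y > 0"
  shows "norm (csc_gf y) > 11 / 96"
proof -
  \<comment> \<open>From pi < 3.15, e < 2.72 and e^(-0.15) at least 0.85.\<close>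
  have "exp pi \<le> exp (1 + 1 + 1 + 15 / 100)"
    using pi_approx by simp
  also have "\<dots> = exp 1 * exp 1 * exp 1 * exp (15 / 100)"
    by (simp only: exp_add)
  also have "\<dots> \<le> 2.72 * 2.72 * 2.72 * (100 / 85)"
  proof (intro mult_mono mult_nonneg_nonneg)
    have "1 - 15 / 100 \<le> exp (- (15 / 100) :: real)"
      using exp_ge_add_one_self[of "- (15 / 100)"] by simp
    then show "exp (15 / 100) \<le> (100 / 85 :: real)"
      by (simp add: exp_minus field_simps)
  qed (use e_less_272 in auto)
  also have "\<dots> < 24" by simp
  finally have epi: "exp pi < 24" .
  have im: "Im y \<le> 1" using abs_Im_le_cmod[of y] assms by simp
  have "norm (sin (of_real pi * y)) \<le> (norm (exp (\<i> * (of_real pi * y))) + norm (exp (- (\<i> * (of_real pi * y))))) / 2"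
    using norm_triangle_ineq4[of "exp (\<i> * (of_real pi * y))" "exp (- (\<i> * (of_real pi * y)))"]
    unfolding sin_exp_eq norm_divide norm_mult by (simp del: norm_exp_eq_Re)
  also have "\<dots> = (exp (- pi * Im y) + exp (pi * Im y)) / 2"
    by simp
  also have "\<dots> \<le> (1 + exp pi) / 2"
    using assms im by (intro divide_right_mono add_mono) auto
  also have "\<dots> < 25 / 2" using epi by simp
  finally have s: "norm (sin (of_real pi * y)) < 25 / 2" .
  have "y \<noteq> 0" "y \<noteq> 1" "y \<noteq> -1" using assms by auto
  then have s0: "norm (sin (of_real pi * y)) > 0"
    using sin_pi_mult_neq_0[of y] assms by simp
  have "11 / 96 < pi / 2 / (25 / 2)" using pi_approx by simp
  also have "\<dots> < pi / 2 / norm (sin (of_real pi * y))"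
    using s s0 by (intro divide_strict_left_mono) auto
  also have "\<dots> = norm (csc_gf y)"
    unfolding csc_gf_def by (simp add: norm_divide norm_mult assms)
  finally show ?thesis .
qed

subsection \<open>The phase of the cosecant\<close>

text \<open>
  A continuous argument of \<open>csc_gf (cis \<phi>)\<close> for \<open>0 < \<phi> < \<pi>\<close>, read off from
  \<open>csc_gf y = -\<i>\<pi> y e\<^sup>\<i>\<^sup>\<pi>\<^sup>y / (1 - e\<^sup>2\<^sup>\<pi>\<^sup>\<i>\<^sup>y)\<close>; there the denominator has positive real part.
\<close>

definition csc_phase :: "real \<Rightarrow> real" where
  "csc_phase \<phi> = - pi / 2 + \<phi> + pi * cos \<phi> - Arg (1 - exp (2 * of_real pi * \<i> * cis \<phi>))"

text \<open>The exponential has modulus e^(-2 pi sin phi) < 1. This keeps 1 - q, with q that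
  exponential, off the branch cut of \<open>Arg\<close>.\<close>

lemma Re_one_minus_exp_pos:
  assumes "0 < \<phi>" "\<phi> < pi"
  shows "Re (1 - exp (2 * of_real pi * \<i> * cis \<phi>)) > 0"
proof -
  have "norm (exp (2 * of_real pi * \<i> * cis \<phi>)) = exp (- (2 * pi * sin \<phi>))"
    by simp
  also have "\<dots> < 1" using sin_gt_zero[OF assms] by simp
  finally show ?thesis using complex_Re_le_cmod[of "exp (2 * of_real pi * \<i> * cis \<phi>)"]
    by (simp del: norm_exp_eq_Re)
qed

text \<open>The factors -i, y, e^(i pi y) and 1/(1 - q) contribute the four summands of
  \<open>csc_phase\<close>; no reduction modulo 2 pi occurs.\<close>

lemma csc_gf_polar:
  assumes "0 < \<phi>" "\<phi> < pi"
  shows "csc_gf (cis \<phi>) = of_real (norm (csc_gf (cis \<phi>))) * cis (csc_phase \<phi>)"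
proof -
  define y where "y = cis \<phi>"
  define q where "q = exp (2 * of_real pi * \<i> * y)"
  have q: "1 - q \<noteq> 0" using Re_one_minus_exp_pos[OF assms] by (auto simp: q_def y_def)
  define E where "E = exp (\<i> * (of_real pi * y))"
  have E0: "E \<noteq> 0" by (simp add: E_def)
  have qE: "q = E\<^sup>2"
    by (simp add: E_def q_def mult_ac flip: exp_double)
  have Em: "exp (- (\<i> * (of_real pi * y))) = 1 / E"
    by (simp add: E_def exp_minus inverse_eq_divide)
  have sE: "sin (of_real pi * y) = (E - 1 / E) / (2 * \<i>)"
    by (simp add: sin_exp_eq E_def[symmetric] Em)
  have s: "sin (of_real pi * y) = \<i> / 2 * (1 - q) / E"
    unfolding sE qE using E0 by (simp add: field_simps power2_eq_square)
  have "csc_gf y = of_real pi * (- \<i>) * y * E / (1 - q)"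
    unfolding csc_gf_def s using E0 q by (simp add: divide_simps)
  moreover have "- \<i> = cis (- pi / 2)" by (simp add: complex_eq_iff)
  moreover have "E = of_real (exp (- (pi * sin \<phi>))) * cis (pi * cos \<phi>)"
    by (simp add: E_def y_def exp_eq_polar)
  moreover have "1 - q = of_real (norm (1 - q)) * cis (Arg (1 - q))"
    using rcis_cmod_Arg[of "1 - q"] by (simp add: rcis_def)
  ultimately have "csc_gf y = of_real pi * cis (- pi / 2) * cis \<phi> *
      (of_real (exp (- (pi * sin \<phi>))) * cis (pi * cos \<phi>)) / (of_real (norm (1 - q)) * cis (Arg (1 - q)))"
    by (simp only: y_def)
  also have "\<dots> = of_real (pi * exp (- (pi * sin \<phi>)) / norm (1 - q)) *
      (cis (- pi / 2) * cis \<phi> * cis (pi * cos \<phi>) / cis (Arg (1 - q)))"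
    by simp
  also have "cis (- pi / 2) * cis \<phi> * cis (pi * cos \<phi>) / cis (Arg (1 - q)) = cis (csc_phase \<phi>)"
    unfolding cis_mult cis_divide by (simp add: csc_phase_def q_def y_def)
  finally have *: "csc_gf y = of_real (pi * exp (- (pi * sin \<phi>)) / norm (1 - q)) * cis (csc_phase \<phi>)" .
  then have "norm (csc_gf y) = pi * exp (- (pi * sin \<phi>)) / norm (1 - q)"
    by (simp add: norm_mult norm_divide del: of_real_mult of_real_divide)
  with * show ?thesis by (simp add: y_def)
qed

text \<open>Replacing y by -cnj y conjugates q, hence negates the argument of 1 - q. This carries
  the behaviour near 0 over to pi.\<close>

lemma csc_phase_reflect:
  assumes "0 < \<phi>" "\<phi> < pi"
  shows "csc_phase (pi - \<phi>) = - csc_phase \<phi>"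
proof -
  let ?q = "exp (2 * of_real pi * \<i> * cis \<phi>)"
  have "cis (pi - \<phi>) = - cnj (cis \<phi>)"
    by (simp add: complex_eq_iff)
  then have "exp (2 * of_real pi * \<i> * cis (pi - \<phi>)) = cnj ?q"
    by (simp add: exp_cnj)
  then have eq: "1 - exp (2 * of_real pi * \<i> * cis (pi - \<phi>)) = cnj (1 - ?q)" by simp
  have "Arg (1 - exp (2 * of_real pi * \<i> * cis (pi - \<phi>))) = - Arg (1 - ?q)"
    unfolding eq Arg_cnj using Re_one_minus_exp_pos[OF assms] by (simp add: Arg_real)
  then show ?thesis by (simp add: csc_phase_def field_simps)
qed

lemma continuous_on_csc_phase: "continuous_on {0<..<pi} csc_phase"
proof -
  have "1 - exp (2 * of_real pi * \<i> * cis \<phi>) \<notin> \<real>\<^sub>\<le>\<^sub>0" if "\<phi> \<in> {0<..<pi}" for \<phi>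
    using Re_one_minus_exp_pos[of \<phi>] that by (auto simp: complex_nonpos_Reals_iff)
  then show ?thesis
    unfolding csc_phase_def by (intro continuous_intros) auto
qed

text \<open>As phi tends to 0, 1 - q tends to 0, where \<open>Arg\<close> is not continuous.
  Dividing by phi > 0 leaves the argument unchanged, and the quotient tends to the derivative 2 pi,
  whose argument is 0.\<close>

lemma csc_phase_tendsto: "(csc_phase \<longlongrightarrow> pi / 2) (at_right 0)"
proof -
  define g where "g \<zeta> = 1 - exp (2 * of_real pi * \<i> * exp (\<i> * \<zeta>))" for \<zeta>
  have "(g has_field_derivative 2 * of_real pi) (at 0)"
    unfolding g_def by (auto intro!: derivative_eq_intros simp: exp_two_pi_i' exp_two_pi_i mult_ac)
  moreover have "g 0 = 0" by (simp add: g_def)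
  ultimately have lim: "((\<lambda>\<zeta>. g \<zeta> / \<zeta>) \<longlongrightarrow> 2 * of_real pi) (at 0)"
    by (simp add: has_field_derivative_iff)
  have "filterlim complex_of_real (at 0) (at_right 0)"
    by (auto simp: filterlim_at eventually_at_filter intro!: tendsto_eq_intros)
  from filterlim_compose[OF lim this]
  have "((\<lambda>\<phi>. g (of_real \<phi>) / of_real \<phi>) \<longlongrightarrow> 2 * of_real pi) (at_right 0)" .
  then have "((\<lambda>\<phi>. Arg (g (of_real \<phi>) / of_real \<phi>)) \<longlongrightarrow> Arg (2 * of_real pi)) (at_right 0)"
    by (intro tendsto_Arg) (auto simp: complex_nonpos_Reals_iff not_le)
  moreover have "Arg (2 * of_real pi) = 0"
    using Arg_of_real[of "2 * pi"] by simp
  moreover have "\<forall>\<^sub>F \<phi> in at_right 0. Arg (g (of_real \<phi>) / of_real \<phi>) = Arg (1 - exp (2 * of_real pi * \<i> * cis \<phi>))"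
    using eventually_at_right_less[of 0]
    by eventually_elim (simp add: g_def cis_conv_exp)
  ultimately have "((\<lambda>\<phi>. Arg (1 - exp (2 * of_real pi * \<i> * cis \<phi>))) \<longlongrightarrow> 0) (at_right 0)"
    using tendsto_cong by fastforce
  then have "(csc_phase \<longlongrightarrow> - pi / 2 + 0 + pi * cos 0 - 0) (at_right 0)"
    unfolding csc_phase_def by (intro tendsto_intros)
  then show ?thesis by (simp add: field_simps)
qed

text \<open>The shifted phase is positive near 0 and below -k pi near pi. Each crossing is sought to
  the right of the previous one, so the points come out increasing.\<close>

lemma csc_phase_crossings:
  fixes k :: nat
  obtains p :: "nat \<Rightarrow> real" where
    "\<And>m. m \<le> k \<Longrightarrow> 0 < p m \<and> p m < pi \<and> csc_phase (p m) - real k * p m = - (real m * pi)"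
    "\<And>m. m < k \<Longrightarrow> p m < p (Suc m)"
proof -
  define \<psi> where "\<psi> x = csc_phase x - real k * x" for x
  have "(\<psi> \<longlongrightarrow> pi / 2 - real k * 0) (at_right 0)"
    unfolding \<psi>_def by (intro tendsto_intros csc_phase_tendsto)
  then have "\<forall>\<^sub>F x in at_right 0. \<psi> x > 0"
    by (intro order_tendstoD(1)[of _ "pi / 2 - real k * 0"]) auto
  moreover have "\<forall>\<^sub>F x in at_right 0. (x::real) \<in> {0<..<pi / 2}"
    by (rule eventually_at_right_real) simp
  ultimately have "\<forall>\<^sub>F x in at_right 0. \<psi> x > 0 \<and> x \<in> {0<..<pi / 2}"
    by (rule eventually_conj)
  then obtain a where a: "\<psi> a > 0" "0 < a" "a < pi / 2"
    using eventually_happens' [OF trivial_limit_at_right_real] by (metis (mono_tags, lifting) greaterThanLessThan_iff)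
  define b where "b = pi - a"
  have ab: "a < b" "b < pi" using a by (auto simp: b_def)
  \<comment> \<open>Reflection gives \<open>\<psi> b = - \<psi> a - real k * pi\<close>.\<close>
  have \<psi>b: "\<psi> b < - (real k * pi)"
    using csc_phase_reflect[of a] a by (simp add: \<psi>_def b_def algebra_simps)
  have step: "\<exists>y\<ge>x. y \<le> b \<and> \<psi> y = t" if "a \<le> x" "x \<le> b" "t \<le> \<psi> x" "- (real k * pi) \<le> t" for x t
  proof -
    have "continuous_on {x..b} \<psi>"
      unfolding \<psi>_def using that ab a
      by (intro continuous_intros continuous_on_subset[OF continuous_on_csc_phase]) auto
    then show ?thesis using IVT2'[of \<psi> b t x] that \<psi>b by force
  qed
  \<comment> \<open>Dependent choice produces an infinite sequence; the guards make its values
    beyond k arbitrary.\<close>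
  let ?P = "\<lambda>m x. m \<le> k \<longrightarrow> a \<le> x \<and> x \<le> b \<and> \<psi> x = - (real m * pi)"
  let ?Q = "\<lambda>m x y. Suc m \<le> k \<longrightarrow> x < y"
  have "\<exists>f. \<forall>m. ?P m (f m) \<and> ?Q m (f m) (f (Suc m))"
  proof (rule dependent_nat_choice)
    show "\<exists>x. ?P 0 x" using step[of a 0] a ab by auto
    show "\<exists>y. ?P (Suc m) y \<and> ?Q m x y" if "?P m x" for x m
    proof (cases "Suc m \<le> k")
      case True
      with that have x: "a \<le> x" "x \<le> b" "\<psi> x = - (real m * pi)" by auto
      have "- (real (Suc m) * pi) < - (real m * pi)" by (simp add: algebra_simps)
      moreover have "- (real k * pi) \<le> - (real (Suc m) * pi)"
        using True by (simp del: of_nat_Suc)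
      ultimately obtain y where y: "x \<le> y" "y \<le> b" "\<psi> y = - (real (Suc m) * pi)"
        using step[of x "- (real (Suc m) * pi)"] x by auto
      moreover have "x \<noteq> y" using x y by (auto simp: algebra_simps)
      ultimately show ?thesis using x by (intro exI[of _ y]) auto
    qed auto
  qed
  then obtain p where p: "\<And>m. ?P m (p m)" "\<And>m. ?Q m (p m) (p (Suc m))"
    by blast
  show ?thesis
  proof (rule that)
    show "0 < p m \<and> p m < pi \<and> csc_phase (p m) - real k * p m = - (real m * pi)" if "m \<le> k" for m
      using p(1)[of m] that a ab by (auto simp: \<psi>_def)
    show "p m < p (Suc m)" if "m < k" for m using p(2)[of m] that by simp
  qed
qed

subsection \<open>Sign changes and zeros\<close>

lemma eta_even_pos: "eta_even j > 0"
proof (cases "j = 0")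
  case False
  then have "(1 / 4 :: real) ^ j \<le> (1 / 4) ^ 1"
    by (intro power_decreasing) auto
  then have "1 / 4 ^ j \<le> (1 / 4 :: real)" by (simp add: power_divide)
  then show ?thesis using eta_even_bounds(1)[of j] False by linarith
qed (simp add: eta_even_def)

text \<open>Equality holds at k = 2, and the left side does not increase with k.\<close>

lemma linear_over_power_four_le:
  assumes "k \<ge> 2"
  shows "(real k + 5 / 3) * (1 / 4) ^ k \<le> 11 / 48"
  using assms
proof (induction k rule: dec_induct)
  case (step n)
  have "(real (Suc n) + 5 / 3) * (1 / 4) ^ Suc n = (real n + 8 / 3) / 4 * (1 / 4) ^ n"
    by (simp add: field_simps)
  also have "\<dots> \<le> (real n + 5 / 3) * (1 / 4) ^ n"
    by (intro mult_right_mono) auto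
  also have "\<dots> \<le> 11 / 48" by (rule step.IH)
  finally show ?case .
qed (simp add: power2_eq_square)

text \<open>The number under \<open>Re\<close> is already real (see \<open>eta_poly_cis\<close>);
  taking \<open>Re\<close> only gives a real-valued function to which the intermediate value theorem
  applies.\<close>

definition eta_trig :: "nat \<Rightarrow> real \<Rightarrow> real" where
  "eta_trig k \<phi> = Re (cnj (cis \<phi>) ^ k * eta_poly k ((cis \<phi>)\<^sup>2))"

text \<open>The coefficients are real and palindromic, so the substitution of k - j for j shows that
  y^-k times the polynomial equals its own conjugate.\<close>

lemma eta_poly_cis: "eta_poly k ((cis \<phi>)\<^sup>2) = cis \<phi> ^ k * of_real (eta_trig k \<phi>)"
proof -
  define y where "y = cis \<phi>"
  define X where "X = cnj y ^ k * eta_poly k (y\<^sup>2)"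
  have yy: "y * cnj y = 1" by (simp add: y_def cis_cnj cis_mult)
  have yk: "y ^ k * cnj y ^ k = 1" by (simp add: yy flip: power_mult_distrib)
  have pw: "y ^ k * (cnj y ^ 2) ^ (k - j) = cnj y ^ k * (y ^ 2) ^ j" if "j \<le> k" for j
  proof -
    have "cnj y ^ k = cnj y ^ (k - j) * cnj y ^ j" "y ^ k = y ^ (k - j) * y ^ j"
      using that by (simp_all flip: power_add)
    then have "y ^ k * (cnj y ^ 2) ^ (k - j) = (y * cnj y) ^ (k - j) * y ^ j * cnj y ^ (k - j)"
      and "cnj y ^ k * (y ^ 2) ^ j = (y * cnj y) ^ j * y ^ j * cnj y ^ (k - j)"
      by (simp_all add: power_mult_distrib power2_eq_square)
    then show ?thesis by (simp add: yy)
  qed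
  have "cnj X = y ^ k * (\<Sum>j\<le>k. of_real (eta_even j * eta_even (k - j)) * (cnj y ^ 2) ^ j)"
    by (simp add: X_def eta_poly_def)
  also have "(\<Sum>j\<le>k. of_real (eta_even j * eta_even (k - j)) * (cnj y ^ 2) ^ j) =
      (\<Sum>j\<le>k. of_real (eta_even j * eta_even (k - j)) * (cnj y ^ 2) ^ (k - j))"
    by (rule sum.reindex_bij_witness[of _ "\<lambda>j. k - j" "\<lambda>j. k - j"]) auto
  also have "y ^ k * \<dots> = X"
    unfolding X_def eta_poly_def sum_distrib_left
    by (intro sum.cong refl) (use pw in \<open>simp add: mult.left_commute\<close>)
  finally have "cnj X = X" .
  then have "X = of_real (Re X)" by (simp add: complex_eq_iff)
  then have "y ^ k * X = y ^ k * of_real (Re X)" by simp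
  moreover have "y ^ k * X = eta_poly k (y\<^sup>2)"
    unfolding X_def mult.assoc[symmetric] yk by simp
  ultimately show ?thesis
    by (simp add: X_def y_def eta_trig_def)
qed

text \<open>At such a point y^-k A is (-1)^m |A|, and the mirrored term is its conjugate. The main
  part 2 |A| exceeds 11/48, which bounds the error.\<close>

lemma eta_trig_alternates:
  assumes "k \<ge> 2" "0 < \<phi>" "\<phi> < pi" and phase: "csc_phase \<phi> - real k * \<phi> = - (real m * pi)"
  shows "(-1) ^ m * eta_trig k \<phi> > 0"
proof -
  define y where "y = cis \<phi>"
  define A where "A = csc_gf y"
  define T where "T = eta_poly k (y\<^sup>2) - (A + (y\<^sup>2) ^ k * cnj A)"
  have s: "sin \<phi> > 0" using assms by (intro sin_gt_zero)
  have y: "norm y = 1" "Im y > 0" using s by (auto simp: y_def)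
  have "y\<^sup>2 \<noteq> 1"
  proof
    assume "y\<^sup>2 = 1"
    then have "y = 1 \<or> y = -1" by (simp add: power2_eq_1_iff)
    with y show False by auto
  qed
  then have T: "norm T \<le> 11 / 48"
    using eta_poly_unit_circle_approx[OF y(1), of k] linear_over_power_four_le[OF assms(1)]
    unfolding T_def A_def by linarith
  have A: "norm A > 11 / 96" unfolding A_def using y by (rule norm_csc_gf_ge)
  have yy: "y * cnj y = 1" by (simp add: y_def cis_cnj cis_mult)
  have "cnj y ^ k * A = cis (- (real k * \<phi>)) * (of_real (norm A) * cis (csc_phase \<phi>))"
    using csc_gf_polar[OF assms(2,3)] by (simp add: y_def A_def cis_cnj Complex.DeMoivre)
  also have "\<dots> = of_real (norm A) * cis (csc_phase \<phi> - real k * \<phi>)"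
    by (simp add: cis_mult mult.left_commute)
  also have "cis (csc_phase \<phi> - real k * \<phi>) = (-1) ^ m"
    unfolding phase by (simp add: complex_eq_iff flip: cis_cnj Complex.DeMoivre)
  finally have main: "cnj y ^ k * A = of_real ((-1) ^ m * norm A)" by simp
  have "cnj y ^ k * ((y\<^sup>2) ^ k * cnj A) = (y * cnj y) ^ k * (y ^ k * cnj A)"
    by (simp add: power_mult_distrib power2_eq_square)
  also have "\<dots> = cnj (cnj y ^ k * A)" by (simp add: yy)
  finally have main': "cnj y ^ k * ((y\<^sup>2) ^ k * cnj A) = of_real ((-1) ^ m * norm A)"
    unfolding main by simp
  have "cnj y ^ k * eta_poly k (y\<^sup>2) = cnj y ^ k * A + cnj y ^ k * ((y\<^sup>2) ^ k * cnj A) + cnj y ^ k * T"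
    by (simp add: T_def algebra_simps)
  then have "eta_trig k \<phi> = 2 * ((-1) ^ m * norm A) + Re (cnj y ^ k * T)"
    unfolding eta_trig_def main main' by (simp add: y_def)
  then have "(-1) ^ m * eta_trig k \<phi> = 2 * norm A + (-1) ^ m * Re (cnj y ^ k * T)"
    by (simp only: distrib_left mult.left_commute[of _ 2] left_minus_one_mult_self)
  moreover have "\<bar>(-1) ^ m * Re (cnj y ^ k * T)\<bar> \<le> norm T"
    using abs_Re_le_cmod[of "cnj y ^ k * T"] by (simp add: abs_mult norm_mult norm_power y)
  ultimately show ?thesis using T A by linarith
qed

text \<open>The k + 1 crossings with alternating signs enclose k zeros of
  \<open>eta_trig\<close>.\<close>

lemma eta_poly_unit_roots:
  assumes "k \<ge> 2"
  obtains R where "card R = k" "finite R" "\<And>w. w \<in> R \<Longrightarrow> norm w = 1 \<and> eta_poly k w = 0"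
proof -
  obtain p where p: "\<And>m. m \<le> k \<Longrightarrow> 0 < p m \<and> p m < pi \<and> csc_phase (p m) - real k * p m = - (real m * pi)"
    "\<And>m. m < k \<Longrightarrow> p m < p (Suc m)"
    using csc_phase_crossings[of k] by blast
  have cont: "continuous_on S (eta_trig k)" for S
    unfolding eta_trig_def eta_poly_def by (intro continuous_intros)
  have "\<exists>x. p m < x \<and> x < p (Suc m) \<and> eta_trig k x = 0" if "m < k" for m
  proof -
    have 1: "(-1) ^ m * eta_trig k (p m) > 0"
      using p(1)[of m] that assms by (intro eta_trig_alternates) auto
    have 2: "(-1) ^ Suc m * eta_trig k (p (Suc m)) > 0"
      using p(1)[of "Suc m"] that assms by (intro eta_trig_alternates) auto
    have "\<exists>x\<ge>p m. x \<le> p (Suc m) \<and> (-1) ^ m * eta_trig k x = 0"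
      by (rule IVT2') (use 1 2 p(2)[OF that] in \<open>auto intro!: continuous_intros cont\<close>)
    then obtain x where x: "p m \<le> x" "x \<le> p (Suc m)" "eta_trig k x = 0" by auto
    moreover have "x \<noteq> p m" "x \<noteq> p (Suc m)" using 1 2 x by auto
    ultimately show ?thesis by (intro exI[of _ x]) auto
  qed
  then obtain t where t: "\<And>m. m < k \<Longrightarrow> p m < t m \<and> t m < p (Suc m) \<and> eta_trig k (t m) = 0"
    by metis
  have p_mono: "p m \<le> p n" if "m \<le> n" "n \<le> k" for m n
    using that
  proof (induction n rule: dec_induct)
    case (step n)
    then show ?case using p(2)[of n] by simp
  qed simp
  have t_less: "t m < t n" if "m < n" "n < k" for m n
    using t[of m] t[of n] p_mono[of "Suc m" n] that by simp
  have t_bounds: "0 < t m" "t m < pi" if "m < k" for m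
    using t[OF that] p(1)[of m] p(1)[of "Suc m"] that by auto
  \<comment> \<open>Squaring identifies only opposite points, and no two points of the open upper
    half circle are opposite.\<close>
  have inj: "inj_on (\<lambda>m. (cis (t m))\<^sup>2) {..<k}"
  proof (rule inj_onI)
    fix m n assume mn: "m \<in> {..<k}" "n \<in> {..<k}" and eq: "(cis (t m))\<^sup>2 = (cis (t n))\<^sup>2"
    then have "cis (t m) = cis (t n) \<or> cis (t m) = - cis (t n)"
      by (simp add: power2_eq_iff)
    moreover have "cis (t m) \<noteq> - cis (t n)"
    proof
      assume "cis (t m) = - cis (t n)"
      from arg_cong[OF this, of Im] have "sin (t m) = - sin (t n)" by simp
      moreover have "sin (t m) > 0" "sin (t n) > 0"
        using mn t_bounds by (auto intro!: sin_gt_zero)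
      ultimately show False by linarith
    qed
    ultimately have "cis (t m) = cis (t n)" by blast
    from arg_cong[OF this, of Re] have cos_eq: "cos (t m) = cos (t n)" by simp
    have "0 \<le> t m" "t m \<le> pi" "0 \<le> t n" "t n \<le> pi"
      using mn t_bounds by (auto intro: less_imp_le)
    then have "t m = t n"
      using cos_eq by (rule cos_inj_pi)
    then show "m = n" using t_less[of m n] t_less[of n m] mn by (cases m n rule: linorder_cases) auto
  qed
  show ?thesis
  proof (rule that[of "(\<lambda>m. (cis (t m))\<^sup>2) ` {..<k}"])
    show "card ((\<lambda>m. (cis (t m))\<^sup>2) ` {..<k}) = k" by (simp add: card_image[OF inj])
    show "norm w = 1 \<and> eta_poly k w = 0" if "w \<in> (\<lambda>m. (cis (t m))\<^sup>2) ` {..<k}" for w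
      using that t by (auto simp: eta_poly_cis norm_power)
  qed simp
qed

text \<open>The degree is at most k, so the k roots found on the circle are all the roots; the
  orders sum to at most k, which forces each to be 1.\<close>

lemma eta_poly_zeros:
  assumes "k \<ge> 2" "eta_poly k w = 0"
  shows "norm w = 1" "deriv (eta_poly k) w \<noteq> 0"
proof -
  define p where "p = (\<Sum>j\<le>k. monom (complex_of_real (eta_even j * eta_even (k - j))) j)"
  have poly_p: "poly p = eta_poly k"
    by (rule ext) (simp add: p_def eta_poly_def poly_sum poly_monom)
  have deg: "degree p \<le> k"
    unfolding p_def by (intro degree_sum_le) (auto intro: degree_monom_le[THEN order.trans])
  have "coeff p 0 = of_real (eta_even 0 * eta_even k)"
    by (simp add: p_def coeff_sum)
  then have p0: "p \<noteq> 0" using eta_even_pos[of 0] eta_even_pos[of k] by auto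
  obtain R where R: "card R = k" "finite R" "\<And>w. w \<in> R \<Longrightarrow> norm w = 1 \<and> eta_poly k w = 0"
    using eta_poly_unit_roots[OF assms(1)] by blast
  have fin: "finite {x. poly p x = 0}" using p0 by (rule poly_roots_finite)
  have sub: "R \<subseteq> {x. poly p x = 0}" using R by (auto simp: poly_p)
  have "card {x. poly p x = 0} \<le> k"
    using card_poly_roots_bound[OF p0] deg by linarith
  then have all: "{x. poly p x = 0} = R"
    using card_subset_eq[OF fin sub] card_mono[OF fin sub] R by simp
  have w: "w \<in> R" using assms all by (auto simp: poly_p)
  then show "norm w = 1" using R by blast
  have ord: "order x p \<ge> 1" if "x \<in> R" for x
    using that all p0 order_root[of p x] by (auto simp: Suc_le_eq)
  have "order w p = 1"
  proof (rule ccontr)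
    assume "order w p \<noteq> 1"
    then have "order w p > 1" using ord[OF w] by linarith
    then have "(\<Sum>x\<in>R. 1) < (\<Sum>x\<in>R. order x p)"
      using ord w R by (intro sum_strict_mono_ex1) auto
    also have "\<dots> \<le> k" using sum_order_le_degree[OF p0] deg all by simp
    finally show False using R by simp
  qed
  moreover have "poly p w = 0" using assms poly_p by simp
  ultimately have "order w (pderiv p) = 0"
    using order_pderiv[OF p0] by force
  moreover have "pderiv p \<noteq> 0"
  proof
    assume "pderiv p = 0"
    then have "degree p = 0" by (simp add: pderiv_eq_0_iff)
    then show False using card_poly_roots_bound[OF p0] all R assms(1) by simp
  qed
  ultimately have "poly (pderiv p) w \<noteq> 0" by (simp add: order_root)
  then show "deriv (eta_poly k) w \<noteq> 0"
    using poly_DERIV[of p w] unfolding poly_p by (simp add: DERIV_imp_deriv)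
qed

section \<open>Closed form of W and reduction to the eta polynomial\<close>

lemma two_powi_one_minus: "(2 :: 'a :: field_char_0) powi (1 - 2 * int j) = 2 / 4 ^ j"
proof -
  have "(2 :: 'a) powi (2 * int j) = 4 ^ j"
    using power_int_of_nat[of "2 :: 'a" "2 * j"] by (simp add: power_mult)
  then show ?thesis by (simp add: power_int_diff)
qed

text \<open>With a = 4^j and b = 4^(k-j), the j-th term acquires the factor ab/2 + 2 - b - a =
  (ab/2)(1 - 2/a)(1 - 2/b). Since ab/2 = 2^(2k-1), the prefactor is half of the one with 2^(2k) in
  the English statement; the zeros are unaffected.\<close>

lemma W_closed_form:
  assumes "k \<ge> 1"
  shows "W k z = of_real ((2 * pi) ^ (2 * k - 1) * 2 ^ (2 * k - 1) / fact (2 * k)) *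
              (\<Sum>j=0..k. (-1) ^ j * of_real (bernoulli (2 * j)) * of_real (bernoulli (2 * k - 2 * j)) *
                 (1 - 2 powi (1 - 2 * int j)) * (1 - 2 powi (1 - 2 * int k + 2 * int j)) *
                 of_nat ((2 * k) choose (2 * j)) * z ^ (2 * j))"
proof -
  define K where "K = complex_of_real ((2 * pi) ^ (2 * k - 1) / fact (2 * k))"
  define c where "c j = (-1) ^ j * complex_of_real (bernoulli (2 * j)) * of_real (bernoulli (2 * k - 2 * j)) *
          of_nat ((2 * k) choose (2 * j))" for j
  define Z where "Z = zeta (of_nat (2 * k - 1))"
  have P: "P k x = K * (\<Sum>j=0..k. c j * x ^ (2 * j)) + Z * (x ^ (2 * k - 1) + (-1) ^ k * x)" for x
    by (simp add: P_def K_def c_def Z_def)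
  have two: "(2 :: complex) ^ (2 * k) = 2 * 2 ^ (2 * k - 1)"
    using assms by (cases k) auto
  \<comment> \<open>The zeta part drops out: the coefficients of z^(2k-1) and of z both
    cancel.\<close>
  have odd_part: "(2 ^ (2 * k - 1) + 2) * (z ^ (2 * k - 1) + (-1) ^ k * z)
      - 2 ^ (2 * k) * ((z / 2) ^ (2 * k - 1) + (-1) ^ k * (z / 2))
      - ((2 * z) ^ (2 * k - 1) + (-1) ^ k * (2 * z)) = 0"
    unfolding two power_divide power_mult_distrib by (simp add: field_simps)
  have term_eq: "(2 ^ (2 * k - 1) + 2) * (c j * z ^ (2 * j)) - 2 ^ (2 * k) * (c j * (z / 2) ^ (2 * j)) - c j * (2 * z) ^ (2 * j) =
      2 ^ (2 * k - 1) * (c j * (1 - 2 powi (1 - 2 * int j)) * (1 - 2 powi (1 - 2 * int k + 2 * int j)) * z ^ (2 * j))"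
    if "j \<le> k" for j
  proof -
    define a b where "a = (4 :: complex) ^ j" and "b = (4 :: complex) ^ (k - j)"
    have nz: "a \<noteq> 0" "b \<noteq> 0" by (auto simp: a_def b_def)
    have "(2 :: complex) ^ (2 * k) = a * b"
      using that by (simp add: a_def b_def power_mult flip: power_add)
    then have ab: "(2 :: complex) ^ (2 * k) = a * b" "(2 :: complex) ^ (2 * k - 1) = a * b / 2"
      using two by (auto simp: mult.commute)
    have "1 - 2 * int k + 2 * int j = 1 - 2 * int (k - j)" using that by simp
    then have pb: "(2 :: complex) powi (1 - 2 * int k + 2 * int j) = 2 / b"
      unfolding b_def by (simp only: two_powi_one_minus)
    have pa: "(2 :: complex) powi (1 - 2 * int j) = 2 / a"
      unfolding a_def by (rule two_powi_one_minus)
    have "(2 :: complex) ^ (2 * j) = a" by (simp add: a_def power_mult)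
    then have zs: "(z / 2) ^ (2 * j) = z ^ (2 * j) / a" "(2 * z) ^ (2 * j) = a * z ^ (2 * j)"
      by (simp_all add: power_divide power_mult_distrib)
    show ?thesis unfolding zs pa pb ab using nz by (simp add: field_simps)
  qed
  have "W k z = K * ((2 ^ (2 * k - 1) + 2) * (\<Sum>j=0..k. c j * z ^ (2 * j)) - 2 ^ (2 * k) * (\<Sum>j=0..k. c j * (z / 2) ^ (2 * j))
        - (\<Sum>j=0..k. c j * (2 * z) ^ (2 * j)))
      + Z * ((2 ^ (2 * k - 1) + 2) * (z ^ (2 * k - 1) + (-1) ^ k * z)
      - 2 ^ (2 * k) * ((z / 2) ^ (2 * k - 1) + (-1) ^ k * (z / 2))
      - ((2 * z) ^ (2 * k - 1) + (-1) ^ k * (2 * z)))"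
    unfolding W_def P by (simp only: algebra_simps)
  also have "\<dots> = K * (\<Sum>j=0..k. (2 ^ (2 * k - 1) + 2) * (c j * z ^ (2 * j)) - 2 ^ (2 * k) * (c j * (z / 2) ^ (2 * j)) - c j * (2 * z) ^ (2 * j))"
    unfolding odd_part sum_subtractf sum_distrib_left by simp
  also have "(\<Sum>j=0..k. (2 ^ (2 * k - 1) + 2) * (c j * z ^ (2 * j)) - 2 ^ (2 * k) * (c j * (z / 2) ^ (2 * j)) - c j * (2 * z) ^ (2 * j)) =
      2 ^ (2 * k - 1) * (\<Sum>j=0..k. c j * (1 - 2 powi (1 - 2 * int j)) * (1 - 2 powi (1 - 2 * int k + 2 * int j)) * z ^ (2 * j))"
    unfolding sum_distrib_left by (intro sum.cong refl term_eq) auto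
  finally show ?thesis
    by (simp add: K_def c_def mult_ac)
qed

text \<open>After Euler's formula the product of the two Bernoulli factors carries (-1)^k / (2
  pi)^(2k), independent of j. The remaining (-1)^j moves into the argument -z^2.\<close>

lemma W_eq_eta_poly:
  assumes "k \<ge> 1"
  obtains D where "D \<noteq> 0" "\<And>z. W k z = D * eta_poly k (- z\<^sup>2)"
proof
  \<comment> \<open>The 4 is the product of the factors -2 from the two uses of
    \<open>bernoulli_even\<close>.\<close>
  define N where "N = fact (2 * k) * 4 * (-1) ^ k / (2 * pi) ^ (2 * k)"
  define M where "M = (2 * pi) ^ (2 * k - 1) * 2 ^ (2 * k - 1) / fact (2 * k)"
  show "complex_of_real (M * N) \<noteq> 0" by (simp add: M_def N_def)
  fix z
  have "W k z = of_real M *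
      (\<Sum>j=0..k. (-1) ^ j * of_real (bernoulli (2 * j)) * of_real (bernoulli (2 * k - 2 * j)) *
                 (1 - 2 powi (1 - 2 * int j)) * (1 - 2 powi (1 - 2 * int k + 2 * int j)) *
                 of_nat ((2 * k) choose (2 * j)) * z ^ (2 * j))"
    unfolding M_def using assms by (rule W_closed_form)
  also have "(\<Sum>j=0..k. (-1) ^ j * of_real (bernoulli (2 * j)) * of_real (bernoulli (2 * k - 2 * j)) *
                 (1 - 2 powi (1 - 2 * int j)) * (1 - 2 powi (1 - 2 * int k + 2 * int j)) *
                 of_nat ((2 * k) choose (2 * j)) * z ^ (2 * j)) = of_real N * eta_poly k (- z\<^sup>2)"
    unfolding eta_poly_def sum_distrib_left atLeast0AtMost
  proof (intro sum.cong refl)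
    fix j assume "j \<in> {..k}"
    then have j: "j \<le> k" by simp
    define i where "i = k - j"
    have k: "k = j + i" and ki: "2 * k - 2 * j = 2 * i" using j by (auto simp: i_def)
    have "1 - 2 * int k + 2 * int j = 1 - 2 * int i" using k by simp
    then have pw: "(2 :: complex) powi (1 - 2 * int k + 2 * int j) = 2 / 4 ^ i"
      by (simp only: two_powi_one_minus)
    have binom: "real ((2 * k) choose (2 * j)) = fact (2 * k) / (fact (2 * j) * fact (2 * i))"
      using j ki by (subst binomial_fact) auto
    have "bernoulli (2 * j) * bernoulli (2 * i) * (1 - 2 / 4 ^ j) * (1 - 2 / 4 ^ i) * real ((2 * k) choose (2 * j))
        = fact (2 * k) * (bernoulli (2 * j) * (1 - 2 / 4 ^ j) / fact (2 * j)) * (bernoulli (2 * i) * (1 - 2 / 4 ^ i) / fact (2 * i))"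
      unfolding binom by simp
    also have "\<dots> = N * (eta_even j * eta_even i)"
      unfolding bernoulli_even N_def k by (simp add: power_add distrib_left)
    finally have "complex_of_real (bernoulli (2 * j) * bernoulli (2 * i) * (1 - 2 / 4 ^ j) * (1 - 2 / 4 ^ i) * real ((2 * k) choose (2 * j)))
        = of_real (N * (eta_even j * eta_even i))" by simp
    moreover have "(- z\<^sup>2) ^ j = (-1) ^ j * z ^ (2 * j)"
      by (subst power_minus) (simp add: power_mult)
    ultimately show "(-1) ^ j * of_real (bernoulli (2 * j)) * of_real (bernoulli (2 * k - 2 * j)) *
                 (1 - 2 powi (1 - 2 * int j)) * (1 - 2 powi (1 - 2 * int k + 2 * int j)) *
                 of_nat ((2 * k) choose (2 * j)) * z ^ (2 * j) =
        of_real N * (of_real (eta_even j * eta_even (k - j)) * (- z\<^sup>2) ^ j)"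
      unfolding pw two_powi_one_minus ki i_def[symmetric] by (simp add: mult_ac)
  qed
  finally show "W k z = of_real (M * N) * eta_poly k (- z\<^sup>2)" by simp
qed

theorem theorem3:
  fixes k :: nat
  assumes "k \<ge> 2"
  shows "(\<forall>z. W k z =
            of_real ((2 * pi) ^ (2 * k - 1) * 2 ^ (2 * k - 1) / fact (2 * k)) *
              (\<Sum>j=0..k. (-1) ^ j * of_real (bernoulli (2 * j)) * of_real (bernoulli (2 * k - 2 * j)) *
                 (1 - 2 powi (1 - 2 * int j)) * (1 - 2 powi (1 - 2 * int k + 2 * int j)) *
                 of_nat ((2 * k) choose (2 * j)) * z ^ (2 * j))) \<and>
         (\<forall>z. W k z = 0 \<longrightarrow> norm z = 1 \<and> zorder (W k) z = 1)"
proof (intro conjI allI impI)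
  show "W k z = of_real ((2 * pi) ^ (2 * k - 1) * 2 ^ (2 * k - 1) / fact (2 * k)) *
              (\<Sum>j=0..k. (-1) ^ j * of_real (bernoulli (2 * j)) * of_real (bernoulli (2 * k - 2 * j)) *
                 (1 - 2 powi (1 - 2 * int j)) * (1 - 2 powi (1 - 2 * int k + 2 * int j)) *
                 of_nat ((2 * k) choose (2 * j)) * z ^ (2 * j))" for z
    using assms by (intro W_closed_form) auto
next
  fix z assume z: "W k z = 0"
  have "k \<ge> 1" using assms by simp
  then obtain D where D: "D \<noteq> 0" "\<And>z. W k z = D * eta_poly k (- z\<^sup>2)"
    using W_eq_eta_poly[of k] by metis
  have root: "eta_poly k (- z\<^sup>2) = 0" using z D by simp
  have "norm (- z\<^sup>2) = 1" using assms root by (rule eta_poly_zeros)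
  then have "norm z ^ 2 = 1" by (simp add: norm_power)
  then show nz: "norm z = 1"
    using norm_ge_zero[of z] power2_eq_1_iff[of "norm z"] by linarith
  have W: "W k = (\<lambda>z. D * eta_poly k (- z\<^sup>2))" by (rule ext) (rule D)
  have hol: "eta_poly k holomorphic_on UNIV"
    unfolding eta_poly_def by (intro holomorphic_intros)
  then have dQ: "(eta_poly k has_field_derivative deriv (eta_poly k) (- z\<^sup>2)) (at (- z\<^sup>2))"
    by (rule holomorphic_derivI) auto
  have "((\<lambda>z. - z\<^sup>2) has_field_derivative - (2 * z)) (at z)"
    by (auto intro!: derivative_eq_intros)
  then have dW: "(W k has_field_derivative D * (deriv (eta_poly k) (- z\<^sup>2) * - (2 * z))) (at z)"
    unfolding W by (intro DERIV_cmult DERIV_chain2[where f = "eta_poly k" and g = "\<lambda>z. - z\<^sup>2"] dQ)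
  \<comment> \<open>The inner derivative -2z does not vanish because |z| = 1, so simple roots of
    \<open>eta_poly\<close> pull back to simple zeros.\<close>
  have "deriv (W k) z \<noteq> 0"
    using DERIV_imp_deriv[OF dW] D nz eta_poly_zeros(2)[OF assms root] by auto
  moreover have "W k analytic_on {z}"
    unfolding W eta_poly_def by (intro analytic_intros)
  ultimately show "zorder (W k) z = 1"
    using z by (intro zorder_zero_eqI') auto
qed

end
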